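(* Let $S$ be a finite set and let $\geq$ be a relation on $2^S$ satisfying (T), (MI) and (Ac), with strict part $>$. Then $>$ satisfies (CAND), (RW), (CM), (CUT), (OR) and (CP). Moreover, if $A > \emptyset$ for every nonempty $A\subseteq S$, then the relation $\vdash$ on $2^S$ defined by $A \vdash B \iff A\cap B > A\cap \overline{B}$ satisfies the postulates of system P except for reflexivity at $A=\emptyset$; that is: $A\vdash A$ for every $A\neq\emptyset$; and for all $A,B,C\subseteq S$: (i) $A\vdash B$ and $B\subseteq C$ imply $A\vdash C$; (ii) $A\vdash C$ and $B\vdash C$ imply $A\cup B\vdash C$; (iii) $A\vdash B$ and $A\vdash C$ imply $A\cap B\vdash C$; (iv) $A\vdash B$ and $A\cap B\vdash C$ imply $A\vdash C$ (left logical equivalence holds automatically, since $\vdash$ is a relation between sets).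
   Context: $S$ is a finite set of states; events are subsets of $S$; $\overline{A}=S\setminus A$. For a relation $\geq$ on $2^S$, the strict part is: $A>B$ iff $A\geq B$ and not $B\geq A$. (T) Transitivity: $A\geq B$ and $B\geq C$ imply $A\geq C$. (MI) $A\subseteq B$ implies $B\geq A$. (Ac) For all pairwise disjoint $A,B,C$: $A\cup B>C$ and $A\cup C>B$ imply $A>B\cup C$. The properties of $>$ (for all $A,B,C\subseteq S$) are: (CAND) $C\cap A> C\cap\overline{A}$ and $C\cap B> C\cap\overline{B}$ imply $C\cap A\cap B> C\cap(\overline{A}\cup\overline{B})$. (OR) $A\cap C>A\cap\overline{C}$ and $B\cap C>B\cap\overline{C}$ imply $(A\cup B)\cap C>(A\cup B)\cap\overline{C}$. (RW) $B\subseteq C$ and $A\cap B>A\cap\overline{B}$ imply $A\cap C>A\cap\overline{C}$. (CM) $A\cap B>A\cap\overline{B}$ and $A\cap C>A\cap\overline{C}$ imply $A\cap B\cap C>A\cap B\cap\overline{C}$. (CUT) $A\cap B>A\cap\overline{B}$ and $A\cap B\cap C>A\cap B\cap\overline{C}$ imply $A\cap C>A\cap\overline{C}$. (CP) For no $A$ does $\emptyset>A$ hold. *)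

theory Defs
  imports Main
begin

text \<open>
  Events are subsets of a state set \<open>S\<close>. A relation on the power set of \<open>S\<close> is a binary
  predicate on sets, and every property below only concerns its values on \<open>Pow S\<close>;
  the complement of an event \<open>A\<close> is \<open>S - A\<close>.
\<close>

definition strict_part :: "('a set \<Rightarrow> 'a set \<Rightarrow> bool) \<Rightarrow> 'a set \<Rightarrow> 'a set \<Rightarrow> bool" where
  "strict_part geq A B \<longleftrightarrow> geq A B \<and> \<not> geq B A"

definition MI :: "'a set \<Rightarrow> ('a set \<Rightarrow> 'a set \<Rightarrow> bool) \<Rightarrow> bool" where
  "MI S geq \<longleftrightarrow> (\<forall>A B. A \<subseteq> S \<longrightarrow> B \<subseteq> S \<longrightarrow> A \<subseteq> B \<longrightarrow> geq B A)"

definition Ac :: "'a set \<Rightarrow> ('a set \<Rightarrow> 'a set \<Rightarrow> bool) \<Rightarrow> bool" where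
  "Ac S geq \<longleftrightarrow> (\<forall>A B C. A \<subseteq> S \<longrightarrow> B \<subseteq> S \<longrightarrow> C \<subseteq> S \<longrightarrow>
     disjnt A B \<longrightarrow> disjnt A C \<longrightarrow> disjnt B C \<longrightarrow>
     strict_part geq (A \<union> B) C \<longrightarrow> strict_part geq (A \<union> C) B \<longrightarrow>
     strict_part geq A (B \<union> C))"

definition CAND :: "'a set \<Rightarrow> ('a set \<Rightarrow> 'a set \<Rightarrow> bool) \<Rightarrow> bool" where
  "CAND S gt \<longleftrightarrow> (\<forall>A B C. A \<subseteq> S \<longrightarrow> B \<subseteq> S \<longrightarrow> C \<subseteq> S \<longrightarrow>
     gt (C \<inter> A) (C \<inter> (S - A)) \<longrightarrow> gt (C \<inter> B) (C \<inter> (S - B)) \<longrightarrow>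
     gt (C \<inter> A \<inter> B) (C \<inter> ((S - A) \<union> (S - B))))"

definition OR :: "'a set \<Rightarrow> ('a set \<Rightarrow> 'a set \<Rightarrow> bool) \<Rightarrow> bool" where
  "OR S gt \<longleftrightarrow> (\<forall>A B C. A \<subseteq> S \<longrightarrow> B \<subseteq> S \<longrightarrow> C \<subseteq> S \<longrightarrow>
     gt (A \<inter> C) (A \<inter> (S - C)) \<longrightarrow> gt (B \<inter> C) (B \<inter> (S - C)) \<longrightarrow>
     gt ((A \<union> B) \<inter> C) ((A \<union> B) \<inter> (S - C)))"

definition RW :: "'a set \<Rightarrow> ('a set \<Rightarrow> 'a set \<Rightarrow> bool) \<Rightarrow> bool" where
  "RW S gt \<longleftrightarrow> (\<forall>A B C. A \<subseteq> S \<longrightarrow> B \<subseteq> S \<longrightarrow> C \<subseteq> S \<longrightarrow>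
     B \<subseteq> C \<longrightarrow> gt (A \<inter> B) (A \<inter> (S - B)) \<longrightarrow> gt (A \<inter> C) (A \<inter> (S - C)))"

definition CM :: "'a set \<Rightarrow> ('a set \<Rightarrow> 'a set \<Rightarrow> bool) \<Rightarrow> bool" where
  "CM S gt \<longleftrightarrow> (\<forall>A B C. A \<subseteq> S \<longrightarrow> B \<subseteq> S \<longrightarrow> C \<subseteq> S \<longrightarrow>
     gt (A \<inter> B) (A \<inter> (S - B)) \<longrightarrow> gt (A \<inter> C) (A \<inter> (S - C)) \<longrightarrow>
     gt (A \<inter> B \<inter> C) (A \<inter> B \<inter> (S - C)))"

definition CUT :: "'a set \<Rightarrow> ('a set \<Rightarrow> 'a set \<Rightarrow> bool) \<Rightarrow> bool" where
  "CUT S gt \<longleftrightarrow> (\<forall>A B C. A \<subseteq> S \<longrightarrow> B \<subseteq> S \<longrightarrow> C \<subseteq> S \<longrightarrow>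
     gt (A \<inter> B) (A \<inter> (S - B)) \<longrightarrow> gt (A \<inter> B \<inter> C) (A \<inter> B \<inter> (S - C)) \<longrightarrow>
     gt (A \<inter> C) (A \<inter> (S - C)))"

definition CP :: "'a set \<Rightarrow> ('a set \<Rightarrow> 'a set \<Rightarrow> bool) \<Rightarrow> bool" where
  "CP S gt \<longleftrightarrow> \<not> (\<exists>A. A \<subseteq> S \<and> gt {} A)"

definition entails :: "'a set \<Rightarrow> ('a set \<Rightarrow> 'a set \<Rightarrow> bool) \<Rightarrow> 'a set \<Rightarrow> 'a set \<Rightarrow> bool" where
  "entails S gt A B \<longleftrightarrow> gt (A \<inter> B) (A \<inter> (S - B))"

end

theory Submission
  imports Defs
begin

text \<open>
  The strict part is monotone: it survives enlarging the left side and shrinking the right side.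
  Hence, by (Ac), a conclusion \<open>X > Y \<union> Z\<close> with \<open>X, Y, Z\<close> pairwise disjoint
  follows from \<open>X \<union> Y > Z\<close> and \<open>X \<union> Z > Y\<close>; each of the properties (CAND), (CUT)
  and (OR) is an instance of this for a suitable partition, up to monotonicity, and (CM) follows
  from (CAND).
\<close>

lemma strict_part_mono:
  assumes "transp_on (Pow S) geq" "MI S geq"
    and gt: "strict_part geq A B"
    and sub: "A \<subseteq> A'" "B' \<subseteq> B" "A' \<subseteq> S" "B \<subseteq> S"
  shows "strict_part geq A' B'"
proof -
  have trans: "geq X Z" if "geq X Y" "geq Y Z" "X \<subseteq> S" "Y \<subseteq> S" "Z \<subseteq> S" for X Y Z
    using assms(1) that by (meson PowI transp_onD)
  have subS: "A \<subseteq> S" "B' \<subseteq> S"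
    using sub by auto
  have "geq A' A" "geq B B'"
    using assms(2) sub subS by (auto simp: MI_def)
  \<comment> \<open>The positive half is the chain \<open>A'\<close>, \<open>A\<close>,
    \<open>B\<close>, \<open>B'\<close>. For the negative half, \<open>geq B' A'\<close> would close
    the chain \<open>B\<close>, \<open>B'\<close>, \<open>A'\<close>, \<open>A\<close> to
    \<open>geq B A\<close>, contradicting \<open>gt\<close>.\<close>
  with gt trans sub subS show ?thesis
    unfolding strict_part_def by meson
qed

text \<open>(Ac) in rule form: one carrier condition and disjointness as empty intersections, so
  that \<open>auto\<close> settles the side conditions of a concrete partition.\<close>

lemma Ac_D:
  assumes "Ac S geq" "strict_part geq (X \<union> Y) Z" "strict_part geq (X \<union> Z) Y"
    and "X \<union> Y \<union> Z \<subseteq> S" "X \<inter> Y = {}" "X \<inter> Z = {}" "Y \<inter> Z = {}"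
  shows "strict_part geq X (Y \<union> Z)"
proof -
  have "X \<subseteq> S" "Y \<subseteq> S" "Z \<subseteq> S"
    using assms(4) by auto
  with assms show ?thesis
    unfolding Ac_def disjnt_def by simp
qed

text \<open>Pure monotonicity: passing from \<open>B\<close> to the larger \<open>C\<close> enlarges
  \<open>A \<inter> B\<close> and shrinks \<open>A \<inter> (S - B)\<close>.\<close>

lemma RW_strict_part:
  assumes "transp_on (Pow S) geq" "MI S geq"
  shows "RW S (strict_part geq)"
  unfolding RW_def
proof (intro allI impI)
  fix A B C
  assume "A \<subseteq> S" "B \<subseteq> C" "strict_part geq (A \<inter> B) (A \<inter> (S - B))"
  then show "strict_part geq (A \<inter> C) (A \<inter> (S - C))"
    by (auto intro: strict_part_mono[OF assms])
qed

lemma CAND_strict_part: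
  assumes "transp_on (Pow S) geq" "MI S geq" "Ac S geq"
  shows "CAND S (strict_part geq)"
  unfolding CAND_def
proof (intro allI impI)
  fix A B C
  assume sub: "A \<subseteq> S" "B \<subseteq> S" "C \<subseteq> S"
    and A: "strict_part geq (C \<inter> A) (C \<inter> (S - A))"
    and B: "strict_part geq (C \<inter> B) (C \<inter> (S - B))"
  \<comment> \<open>A partition of \<open>C\<close>. Premise \<open>A\<close> compares
    \<open>?X \<union> ?Y\<close> with \<open>?Z\<close> as it stands; in premise \<open>B\<close>,
    the points of \<open>C\<close> outside both \<open>A\<close> and \<open>B\<close> move from the
    right side to the left.\<close>
  let ?X = "C \<inter> A \<inter> B" and ?Y = "(C \<inter> A) - B" and ?Z = "C - A"
  have "strict_part geq (?X \<union> ?Y) ?Z"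
    by (rule strict_part_mono[OF assms(1,2) A]) (use sub in auto)
  moreover have "strict_part geq (?X \<union> ?Z) ?Y"
    by (rule strict_part_mono[OF assms(1,2) B]) (use sub in auto)
  ultimately have "strict_part geq ?X (?Y \<union> ?Z)"
    by (rule Ac_D[OF assms(3)]) (use sub in auto)
  then show "strict_part geq ?X (C \<inter> ((S - A) \<union> (S - B)))"
    by (rule strict_part_mono[OF assms(1,2)]) (use sub in auto)
qed

lemma CM_strict_part:
  assumes "transp_on (Pow S) geq" "MI S geq" "Ac S geq"
  shows "CM S (strict_part geq)"
  unfolding CM_def
proof (intro allI impI)
  fix A B C
  assume sub: "A \<subseteq> S" "B \<subseteq> S" "C \<subseteq> S"
    and "strict_part geq (A \<inter> B) (A \<inter> (S - B))" "strict_part geq (A \<inter> C) (A \<inter> (S - C))"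
  then have "strict_part geq (A \<inter> B \<inter> C) (A \<inter> ((S - B) \<union> (S - C)))"
    using CAND_strict_part[OF assms] unfolding CAND_def by blast
  \<comment> \<open>(CAND) inside \<open>A\<close> bounds all of \<open>A\<close> outside
    \<open>B \<inter> C\<close>; only the part lying in \<open>B\<close> is kept.\<close>
  then show "strict_part geq (A \<inter> B \<inter> C) (A \<inter> B \<inter> (S - C))"
    by (rule strict_part_mono[OF assms(1,2)]) (use sub in auto)
qed

lemma CUT_strict_part:
  assumes "transp_on (Pow S) geq" "MI S geq" "Ac S geq"
  shows "CUT S (strict_part geq)"
  unfolding CUT_def
proof (intro allI impI)
  fix A B C
  assume sub: "A \<subseteq> S" "B \<subseteq> S" "C \<subseteq> S"
    and B: "strict_part geq (A \<inter> B) (A \<inter> (S - B))"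
    and C: "strict_part geq (A \<inter> B \<inter> C) (A \<inter> B \<inter> (S - C))"
  \<comment> \<open>A partition of \<open>A\<close>. Premise \<open>C\<close> reads
    \<open>?X > ?Y\<close>, and \<open>?Z\<close> is added on its left. The resulting
    \<open>?Y \<union> ?Z\<close> contains \<open>A - C\<close>, while \<open>?X\<close> lies in
    \<open>A \<inter> C\<close>.\<close>
  let ?X = "A \<inter> B \<inter> C" and ?Y = "(A \<inter> B) - C" and ?Z = "A - B"
  have "strict_part geq (?X \<union> ?Y) ?Z"
    by (rule strict_part_mono[OF assms(1,2) B]) (use sub in auto)
  moreover have "strict_part geq (?X \<union> ?Z) ?Y"
    by (rule strict_part_mono[OF assms(1,2) C]) (use sub in auto)
  ultimately have "strict_part geq ?X (?Y \<union> ?Z)"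
    by (rule Ac_D[OF assms(3)]) (use sub in auto)
  then show "strict_part geq (A \<inter> C) (A \<inter> (S - C))"
    by (rule strict_part_mono[OF assms(1,2)]) (use sub in auto)
qed

lemma OR_strict_part:
  assumes "transp_on (Pow S) geq" "MI S geq" "Ac S geq"
  shows "OR S (strict_part geq)"
  unfolding OR_def
proof (intro allI impI)
  fix A B C
  assume sub: "A \<subseteq> S" "B \<subseteq> S" "C \<subseteq> S"
    and A: "strict_part geq (A \<inter> C) (A \<inter> (S - C))"
    and B: "strict_part geq (B \<inter> C) (B \<inter> (S - C))"
  \<comment> \<open>\<open>A - C\<close> and \<open>B - C\<close> may overlap; assigning the overlap
    to \<open>?Z\<close> makes the pieces disjoint, with \<open>?Y \<union> ?Z\<close> equal to
    \<open>(A \<union> B) - C\<close>.\<close>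
  let ?X = "(A \<union> B) \<inter> C" and ?Y = "B - A - C" and ?Z = "A - C"
  have "strict_part geq (?X \<union> ?Y) ?Z"
    by (rule strict_part_mono[OF assms(1,2) A]) (use sub in auto)
  moreover have "strict_part geq (?X \<union> ?Z) ?Y"
    by (rule strict_part_mono[OF assms(1,2) B]) (use sub in auto)
  ultimately have "strict_part geq ?X (?Y \<union> ?Z)"
    by (rule Ac_D[OF assms(3)]) (use sub in auto)
  then show "strict_part geq ?X ((A \<union> B) \<inter> (S - C))"
    by (rule strict_part_mono[OF assms(1,2)]) (use sub in auto)
qed

text \<open>Since \<open>{}\<close> is contained in \<open>A\<close>, (MI) gives
  \<open>geq A {}\<close>, which rules out \<open>{} > A\<close>.\<close>

lemma CP_strict_part:
  assumes "MI S geq"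
  shows "CP S (strict_part geq)"
  using assms unfolding CP_def MI_def strict_part_def by blast

theorem theorem1:
  fixes S :: "'a set" and geq :: "'a set \<Rightarrow> 'a set \<Rightarrow> bool"
  assumes "finite S"
    and "transp_on (Pow S) geq"
    and "MI S geq"
    and "Ac S geq"
  shows "CAND S (strict_part geq) \<and> RW S (strict_part geq) \<and> CM S (strict_part geq) \<and>
         CUT S (strict_part geq) \<and> OR S (strict_part geq) \<and> CP S (strict_part geq) \<and>
         ((\<forall>A. A \<subseteq> S \<longrightarrow> A \<noteq> {} \<longrightarrow> strict_part geq A {}) \<longrightarrow>
           (\<forall>A. A \<subseteq> S \<longrightarrow> A \<noteq> {} \<longrightarrow> entails S (strict_part geq) A A) \<and>
           (\<forall>A B C. A \<subseteq> S \<longrightarrow> B \<subseteq> S \<longrightarrow> C \<subseteq> S \<longrightarrow>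
              (entails S (strict_part geq) A B \<longrightarrow> B \<subseteq> C \<longrightarrow>
                 entails S (strict_part geq) A C) \<and>
              (entails S (strict_part geq) A C \<longrightarrow> entails S (strict_part geq) B C \<longrightarrow>
                 entails S (strict_part geq) (A \<union> B) C) \<and>
              (entails S (strict_part geq) A B \<longrightarrow> entails S (strict_part geq) A C \<longrightarrow>
                 entails S (strict_part geq) (A \<inter> B) C) \<and>
              (entails S (strict_part geq) A B \<longrightarrow> entails S (strict_part geq) (A \<inter> B) C \<longrightarrow>
                 entails S (strict_part geq) A C)))"
proof -
  note props = RW_strict_part[OF assms(2,3)] OR_strict_part[OF assms(2-4)]
    CM_strict_part[OF assms(2-4)] CUT_strict_part[OF assms(2-4)]
  \<comment> \<open>Once \<open>entails\<close> is unfolded, the four rules are literally (RW),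
    (OR), (CM) and (CUT).\<close>
  have P: "entails S (strict_part geq) A B \<Longrightarrow> B \<subseteq> C \<Longrightarrow> entails S (strict_part geq) A C"
      "entails S (strict_part geq) A C \<Longrightarrow> entails S (strict_part geq) B C \<Longrightarrow>
        entails S (strict_part geq) (A \<union> B) C"
      "entails S (strict_part geq) A B \<Longrightarrow> entails S (strict_part geq) A C \<Longrightarrow>
        entails S (strict_part geq) (A \<inter> B) C"
      "entails S (strict_part geq) A B \<Longrightarrow> entails S (strict_part geq) (A \<inter> B) C \<Longrightarrow>
        entails S (strict_part geq) A C"
    if "A \<subseteq> S" "B \<subseteq> S" "C \<subseteq> S" for A B C
    unfolding entails_def
    subgoal by (rule props(1)[unfolded RW_def, rule_format, OF that])
    subgoal by (rule props(2)[unfolded OR_def, rule_format, OF that])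
    subgoal by (rule props(3)[unfolded CM_def, rule_format, OF that])
    subgoal by (rule props(4)[unfolded CUT_def, rule_format, OF that])
    done
  have refl: "entails S (strict_part geq) A A"
    if "\<forall>A. A \<subseteq> S \<longrightarrow> A \<noteq> {} \<longrightarrow> strict_part geq A {}" "A \<subseteq> S" "A \<noteq> {}" for A
  proof -
    \<comment> \<open>So \<open>A\<close> entails itself exactly when \<open>A > {}\<close>, the
      extra assumption; for empty \<open>A\<close> this would be \<open>{} > {}\<close>, which (CP)
      excludes.\<close>
    have "A \<inter> (S - A) = {}"
      by auto
    with that show ?thesis
      by (simp add: entails_def)
  qed
  show ?thesis
    by (intro conjI impI allI props CAND_strict_part[OF assms(2-4)] CP_strict_part[OF assms(3)])
      (rule refl P; assumption)+
qed

end
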